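(* For every integer $k \geq 1$ and every $p \in (0,1)$, the set $\mathbf{H}_{k,p}$ is a closed subset of $\mathbb{R}$, and moreover \[ \mathbf{H}_{k,p} = \{0\} \cup \{\mathrm{id}_p(\mathcal{H}) \mid \mathcal{H} \text{ is a finite hypergraph with } r(\mathcal{H}) \leq k\}. \]
   Context: A hypergraph $\mathcal{H}$ consists of a vertex set $V(\mathcal{H})$ and a set $E(\mathcal{H})$ of finite subsets of $V(\mathcal{H})$ (hyperedges); we write $E \in \mathcal{H}$ for $E \in E(\mathcal{H})$. A set $I \subseteq V(\mathcal{H})$ is independent if it contains no hyperedge; $\mathcal{I}(\mathcal{H})$ denotes the set of independent sets. The rank $r(\mathcal{H})$ is the supremum of the sizes of hyperedges. For a finite hypergraph $\mathcal{H}$ on $n$ vertices and $p \in (0,1)$, the independence $p$-density is $\mathrm{id}_p(\mathcal{H}) = \sum_{I \in \mathcal{I}(\mathcal{H})} p^{|I|}(1-p)^{n-|I|}$, i.e. the probability that a random vertex subset, each vertex included independently with probability $p$, is independent. For a countable hypergraph $\mathcal{H}$, a chain for $\mathcal{H}$ is a sequence $(\mathcal{C}_n)_{n\ge1}$ of finite hypergraphs with each $\mathcal{C}_n$ an induced subhypergraph of $\mathcal{C}_{n+1}$, $\bigcup_n V(\mathcal{C}_n) = V(\mathcal{H})$ and $\bigcup_n E(\mathcal{C}_n) = E(\mathcal{H})$; then $\mathrm{id}_p(\mathcal{H}) = \lim_{n\to\infty} \mathrm{id}_p(\mathcal{C}_n)$ (this limit is independent of the chain). For $k \ge 1$ and $p\in(0,1)$,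 $\mathbf{H}_{k,p} = \{\mathrm{id}_p(\mathcal{H}) \mid \mathcal{H} \text{ a countable hypergraph with } r(\mathcal{H}) \le k\}$ (countable includes finite). *)

theory Defs
  imports Complex_Main "HOL-Library.Extended_Nat" "HOL-Library.Countable_Set"
begin

record 'a hypergraph =
  verts :: "'a set"
  edges :: "'a set set"

definition hypergraph :: "'a hypergraph \<Rightarrow> bool" where
  "hypergraph H \<longleftrightarrow> (\<forall>E\<in>edges H. finite E \<and> E \<subseteq> verts H)"

definition finite_hypergraph :: "'a hypergraph \<Rightarrow> bool" where
  "finite_hypergraph H \<longleftrightarrow> hypergraph H \<and> finite (verts H)"

definition countable_hypergraph :: "'a hypergraph \<Rightarrow> bool" where
  "countable_hypergraph H \<longleftrightarrow> hypergraph H \<and> countable (verts H)"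

definition rank :: "'a hypergraph \<Rightarrow> enat" where
  "rank H = (SUP E\<in>edges H. enat (card E))"

definition independent :: "'a hypergraph \<Rightarrow> 'a set \<Rightarrow> bool" where
  "independent H I \<longleftrightarrow> I \<subseteq> verts H \<and> \<not> (\<exists>E\<in>edges H. E \<subseteq> I)"

definition fin_indep_density :: "real \<Rightarrow> 'a hypergraph \<Rightarrow> real" where
  "fin_indep_density p H =
     (\<Sum>I | independent H I. p ^ card I * (1 - p) ^ (card (verts H) - card I))"

definition induced_subhypergraph :: "'a hypergraph \<Rightarrow> 'a hypergraph \<Rightarrow> bool" where
  "induced_subhypergraph G H \<longleftrightarrow>
     verts G \<subseteq> verts H \<and> edges G = {E \<in> edges H. E \<subseteq> verts G}"

definition hchain :: "(nat \<Rightarrow> 'a hypergraph) \<Rightarrow> 'a hypergraph \<Rightarrow> bool" where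
  "hchain C H \<longleftrightarrow>
     (\<forall>n. finite_hypergraph (C n)) \<and>
     (\<forall>n. induced_subhypergraph (C n) (C (Suc n))) \<and>
     (\<Union>n. verts (C n)) = verts H \<and>
     (\<Union>n. edges (C n)) = edges H"

text \<open>The common limit of the finite densities along all chains; meaningful for countable
  hypergraphs only, since no others have a chain.\<close>

definition indep_density :: "real \<Rightarrow> 'a hypergraph \<Rightarrow> real" where
  "indep_density p H =
     (THE L. \<forall>C. hchain C H \<longrightarrow> (\<lambda>n. fin_indep_density p (C n)) \<longlonglongrightarrow> L)"

text \<open>Up to isomorphism the vertices of a countable hypergraph may be taken to be natural
  numbers, so that the collection of all countable hypergraphs is replaced by the
  type \<^typ>\<open>nat hypergraph\<close>; \<open>indep_density_in_indep_densities\<close> and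
  \<open>fin_indep_density_nat\<close> below show that hypergraphs over other types give no new densities.\<close>

definition indep_densities :: "nat \<Rightarrow> real \<Rightarrow> real set" where
  "indep_densities k p =
     {indep_density p H | H :: nat hypergraph. countable_hypergraph H \<and> rank H \<le> enat k}"

definition relabel :: "('a \<Rightarrow> 'b) \<Rightarrow> 'a hypergraph \<Rightarrow> 'b hypergraph" where
  "relabel f H = \<lparr>verts = f ` verts H, edges = (`) f ` edges H\<rparr>"

lemma relabel_simps [simp]:
  "verts (relabel f H) = f ` verts H" "edges (relabel f H) = (`) f ` edges H"
  by (simp_all add: relabel_def)

lemma hypergraph_relabel: "hypergraph H \<Longrightarrow> hypergraph (relabel f H)"
  by (auto simp: hypergraph_def)

lemma rank_relabel:
  assumes "hypergraph H" "inj_on f (verts H)"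
  shows "rank (relabel f H) = rank H"
proof -
  have "card (f ` E) = card E" if "E \<in> edges H" for E
    using assms that by (meson card_image hypergraph_def inj_on_subset)
  then show ?thesis by (simp add: rank_def image_image)
qed

lemma image_subset_iff_inj:
  "inj_on f V \<Longrightarrow> A \<subseteq> V \<Longrightarrow> B \<subseteq> V \<Longrightarrow> f ` A \<subseteq> f ` B \<longleftrightarrow> A \<subseteq> B"
  unfolding inj_on_def by blast

lemma independent_relabel:
  assumes "hypergraph H" "inj_on f (verts H)"
  shows "{I. independent (relabel f H) I} = (`) f ` {I. independent H I}"
proof -
  have *: "independent (relabel f H) (f ` J) \<longleftrightarrow> independent H J" if "J \<subseteq> verts H" for J
  proof -
    have "f ` E \<subseteq> f ` J \<longleftrightarrow> E \<subseteq> J" if "E \<in> edges H" for E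
      using assms that \<open>J \<subseteq> verts H\<close> unfolding hypergraph_def
      by (intro image_subset_iff_inj[of f "verts H"]) auto
    then show ?thesis
      using that by (simp add: independent_def image_mono)
  qed
  show ?thesis
  proof (intro equalityI subsetI)
    fix I assume "I \<in> {I. independent (relabel f H) I}"
    moreover from this obtain J where "J \<subseteq> verts H" "I = f ` J"
      by (auto simp: independent_def subset_image_iff)
    ultimately show "I \<in> (`) f ` {I. independent H I}" using * by blast
  next
    fix I assume "I \<in> (`) f ` {I. independent H I}"
    then show "I \<in> {I. independent (relabel f H) I}"
      using * by (auto simp: independent_def)
  qed
qed

lemma fin_indep_density_relabel:
  assumes "hypergraph H" "inj_on f (verts H)"
  shows "fin_indep_density p (relabel f H) = fin_indep_density p H"
proof -
  have inj: "inj_on ((`) f) {I. independent H I}"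
    using assms(2) by (intro inj_onI) (auto simp: independent_def inj_on_image_eq_iff)
  have "card (f ` I) = card I" if "independent H I" for I
    using assms that by (meson card_image independent_def inj_on_subset)
  moreover have "card (f ` verts H) = card (verts H)"
    using assms(2) by (rule card_image)
  ultimately show ?thesis
    unfolding fin_indep_density_def independent_relabel[OF assms]
    by (subst sum.reindex[OF inj]) simp
qed

lemma induced_relabel:
  assumes "hypergraph G" "induced_subhypergraph F G" "inj_on f (verts G)"
  shows "induced_subhypergraph (relabel f F) (relabel f G)"
proof -
  have "f ` E \<subseteq> f ` verts F \<longleftrightarrow> E \<subseteq> verts F" if "E \<in> edges G" for E
    using assms that unfolding hypergraph_def induced_subhypergraph_def
    by (intro image_subset_iff_inj[of f "verts G"]) auto
  then show ?thesis
    using assms(2) unfolding induced_subhypergraph_def by auto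
qed

lemma hchain_relabel:
  assumes "hchain C H" "inj_on f (verts H)"
  shows "hchain (\<lambda>n. relabel f (C n)) (relabel f H)"
proof -
  have sub: "verts (C n) \<subseteq> verts H" for n
    using assms(1) by (auto simp: hchain_def)
  then have "induced_subhypergraph (relabel f (C n)) (relabel f (C (Suc n)))" for n
    using assms(1) inj_on_subset[OF assms(2) sub]
    by (intro induced_relabel) (auto simp: hchain_def finite_hypergraph_def)
  moreover have "finite_hypergraph (relabel f (C n))" for n
    using assms(1) by (auto simp: hchain_def finite_hypergraph_def intro: hypergraph_relabel)
  moreover have "verts H = (\<Union>n. verts (C n))" "edges H = (\<Union>n. edges (C n))"
    using assms(1) by (auto simp: hchain_def)
  ultimately show ?thesis unfolding hchain_def by auto
qed

lemma relabel_inverse: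
  assumes "hypergraph H" "inj_on f (verts H)"
  shows "relabel (inv_into (verts H) f) (relabel f H) = H"
proof -
  have *: "inv_into (verts H) f ` f ` A = A" if "A \<subseteq> verts H" for A
    using assms(2) that by (rule inv_into_image_cancel)
  then have "(`) (inv_into (verts H) f) ` (`) f ` edges H = (\<lambda>x. x) ` edges H"
    unfolding image_image using assms(1)
    by (intro image_cong refl) (simp add: hypergraph_def image_image)
  with * show ?thesis by (simp add: relabel_def)
qed

lemma indep_density_relabel:
  assumes "hypergraph H" "inj_on f (verts H)"
  shows "indep_density p (relabel f H) = indep_density p H"
proof -
  have transfer: "(\<lambda>n. fin_indep_density p (C n)) \<longlonglongrightarrow> L"
    if "hchain C H" "inj_on f (verts H)"
      and "\<forall>C. hchain C (relabel f H) \<longrightarrow> (\<lambda>n. fin_indep_density p (C n)) \<longlonglongrightarrow> L"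
    for C L and f :: "'c \<Rightarrow> 'd" and H
  proof -
    have "verts (C n) \<subseteq> verts H" "hypergraph (C n)" for n
      using that(1) by (auto simp: hchain_def finite_hypergraph_def)
    then have "inj_on f (verts (C n))" "hypergraph (C n)" for n
      using inj_on_subset[OF that(2)] by auto
    then show ?thesis
      using that(3) hchain_relabel[OF that(1,2)] by (force simp: fin_indep_density_relabel)
  qed
  let ?g = "inv_into (verts H) f"
  have inv: "relabel ?g (relabel f H) = H" "inj_on ?g (verts (relabel f H))"
    using relabel_inverse[OF assms] by (simp_all add: inj_on_inv_into)
  have "(\<forall>C. hchain C (relabel f H) \<longrightarrow> (\<lambda>n. fin_indep_density p (C n)) \<longlonglongrightarrow> L) \<longleftrightarrow>
        (\<forall>C. hchain C H \<longrightarrow> (\<lambda>n. fin_indep_density p (C n)) \<longlonglongrightarrow> L)" for L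
    using transfer[OF _ assms(2), of _ L] transfer[OF _ inv(2), of _ L]
    unfolding inv(1) by blast
  then show ?thesis by (simp add: indep_density_def)
qed

lemma indep_density_in_indep_densities:
  fixes H :: "'a hypergraph"
  assumes "countable_hypergraph H" "rank H \<le> enat k"
  shows "indep_density p H \<in> indep_densities k p"
proof -
  have hyp: "hypergraph H" and "countable (verts H)"
    using assms(1) by (auto simp: countable_hypergraph_def)
  then have inj: "inj_on (to_nat_on (verts H)) (verts H)" by (intro inj_on_to_nat_on)
  let ?G = "relabel (to_nat_on (verts H)) H"
  have "countable_hypergraph ?G" "rank ?G \<le> enat k"
    using assms hypergraph_relabel[OF hyp] rank_relabel[OF hyp inj]
    by (auto simp: countable_hypergraph_def)
  then show ?thesis
    unfolding indep_densities_def using indep_density_relabel[OF hyp inj, of p] by force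
qed

lemma fin_indep_density_nat:
  fixes H :: "'a hypergraph"
  assumes "finite_hypergraph H"
  obtains G :: "nat hypergraph" where "finite_hypergraph G" "rank G = rank H"
    "fin_indep_density p G = fin_indep_density p H"
proof
  have hyp: "hypergraph H" and "finite (verts H)"
    using assms by (auto simp: finite_hypergraph_def)
  then have inj: "inj_on (to_nat_on (verts H)) (verts H)" by (intro inj_on_to_nat_on countable_finite)
  let ?G = "relabel (to_nat_on (verts H)) H"
  show "finite_hypergraph ?G" "rank ?G = rank H"
    "fin_indep_density p ?G = fin_indep_density p H"
    using assms hyp inj
    by (auto simp: finite_hypergraph_def hypergraph_relabel rank_relabel
        fin_indep_density_relabel)
qed

end

theory Submission
  imports Defs
begin

text \<open>The density of a countable hypergraph is a limit of densities of finite ones of the same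
  rank bound, so everything follows once the set of finite densities is shown to be closed.

  Let \<open>x\<close> be a limit of such densities, realised by antichains of edges. A sunflower with \<open>M\<close>
  petals in the edge set can be replaced by its core at the cost of changing the density by at most
  \<open>(1 - p ^ k) ^ M\<close>: given the core, the petals must all be missed, and they are disjoint. Choose
  the vector (number of edges of size 0, 1, ..., \<open>k\<close>) lexicographically maximal among those
  occurring arbitrarily close to \<open>x\<close>. The maximum exists: if the number of edges of size \<open>j\<close> were
  unbounded, there would be arbitrarily large sunflowers of edges of size \<open>j\<close>, and passing to the
  core keeps the approximation while increasing an earlier entry. Hence \<open>x\<close> is approximated by
  hypergraphs with a fixed number of edges, which have only finitely many densities.\<close>

section \<open>Random subsets of a finite set\<close>

definition subset_prob :: "real \<Rightarrow> 'a set \<Rightarrow> ('a set \<Rightarrow> bool) \<Rightarrow> real" where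
  "subset_prob p V X = (\<Sum>I | I \<subseteq> V \<and> X I. p ^ card I * (1 - p) ^ (card V - card I))"

lemma subset_prob_cong:
  "(\<And>I. I \<subseteq> V \<Longrightarrow> X I \<longleftrightarrow> Y I) \<Longrightarrow> subset_prob p V X = subset_prob p V Y"
  unfolding subset_prob_def by (rule sum.cong) auto

lemma subset_prob_mono:
  assumes "0 \<le> p" "p \<le> 1" "finite V" "\<And>I. I \<subseteq> V \<Longrightarrow> X I \<Longrightarrow> Y I"
  shows "subset_prob p V X \<le> subset_prob p V Y"
  unfolding subset_prob_def using assms by (intro sum_mono2) auto

lemma subset_prob_nonneg: "0 \<le> p \<Longrightarrow> p \<le> 1 \<Longrightarrow> 0 \<le> subset_prob p V X"
  unfolding subset_prob_def by (intro sum_nonneg) auto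

lemma subset_prob_split:
  assumes "finite V"
  shows "subset_prob p V X =
    subset_prob p V (\<lambda>I. X I \<and> Y I) + subset_prob p V (\<lambda>I. X I \<and> \<not> Y I)"
proof -
  have "{I. I \<subseteq> V \<and> X I} = {I. I \<subseteq> V \<and> X I \<and> Y I} \<union> {I. I \<subseteq> V \<and> X I \<and> \<not> Y I}" by blast
  then show ?thesis
    unfolding subset_prob_def using assms by (simp add: sum.union_disjoint[symmetric] disjoint_iff)
qed

lemma subset_prob_True:
  assumes "finite V"
  shows "subset_prob p V (\<lambda>_. True) = 1"
proof -
  have "(\<Prod>v\<in>V. p + (1 - p)) = (\<Sum>I\<in>Pow V. (\<Prod>v\<in>I. p) * (\<Prod>v\<in>V - I. 1 - p))"
    using assms by (rule prod_add)
  also have "\<dots> = (\<Sum>I\<in>Pow V. p ^ card I * (1 - p) ^ (card V - card I))"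
    using assms by (intro sum.cong) (auto simp: card_Diff_subset finite_subset)
  finally show ?thesis by (simp add: subset_prob_def Pow_def)
qed

text \<open>Events decided on disjoint ground sets are independent: a subset of
  \<open>A \<union> B\<close> splits uniquely into its traces on \<open>A\<close> and
  \<open>B\<close>, and its weight is the product of theirs.\<close>

lemma subset_prob_indep:
  assumes "finite A" "finite B" "A \<inter> B = {}"
  shows "subset_prob p (A \<union> B) (\<lambda>I. X (I \<inter> A) \<and> Y (I \<inter> B)) = subset_prob p A X * subset_prob p B Y"
proof -
  let ?w = "\<lambda>V I. p ^ card I * (1 - p) ^ (card V - card I)"
  have "?w A I * ?w B J = ?w (A \<union> B) (I \<union> J)" if "I \<subseteq> A" "J \<subseteq> B" for I J
  proof -
    have fin: "finite I" "finite J" "I \<inter> J = {}" using that assms finite_subset by blast+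
    have le: "card I \<le> card A" "card J \<le> card B" using that assms by (auto intro: card_mono)
    have "card (I \<union> J) = card I + card J" using fin by (simp add: card_Un_disjoint)
    moreover have "card (A \<union> B) = card A + card B" using assms by (simp add: card_Un_disjoint)
    \<comment> \<open>Subtraction of naturals truncates; the exponents of \<open>1 - p\<close> add
      up because \<open>I\<close> and \<open>J\<close> are no larger than \<open>A\<close> and
      \<open>B\<close>.\<close>
    moreover have "card A + card B - (card I + card J) = (card A - card I) + (card B - card J)"
      using le by simp
    ultimately show ?thesis by (simp add: power_add)
  qed
  then have "subset_prob p A X * subset_prob p B Y =
      (\<Sum>(I, J)\<in>{I. I \<subseteq> A \<and> X I} \<times> {J. J \<subseteq> B \<and> Y J}. ?w (A \<union> B) (I \<union> J))"
    unfolding subset_prob_def sum_product sum.cartesian_product by (intro sum.cong) auto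
  also have "\<dots> = subset_prob p (A \<union> B) (\<lambda>I. X (I \<inter> A) \<and> Y (I \<inter> B))"
    unfolding subset_prob_def
  proof (rule sum.reindex_bij_witness[where i = "\<lambda>I. (I \<inter> A, I \<inter> B)" and j = "\<lambda>(I, J). I \<union> J"])
    fix a assume a: "a \<in> {I. I \<subseteq> A \<and> X I} \<times> {J. J \<subseteq> B \<and> Y J}"
    then obtain I J where IJ: "a = (I, J)" "I \<subseteq> A" "X I" "J \<subseteq> B" "Y J" by blast
    then have e: "(I \<union> J) \<inter> A = I" "(I \<union> J) \<inter> B = J" using assms(3) by blast+
    then show "((case a of (I, J) \<Rightarrow> I \<union> J) \<inter> A, (case a of (I, J) \<Rightarrow> I \<union> J) \<inter> B) = a"
      using IJ by simp
    show "(case a of (I, J) \<Rightarrow> I \<union> J) \<in> {I. I \<subseteq> A \<union> B \<and> X (I \<inter> A) \<and> Y (I \<inter> B)}"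
      using IJ e by auto
  qed auto
  finally show ?thesis ..
qed

text \<open>Vertices outside \<open>U\<close> contribute an independent event that always holds,
  hence the factor 1.\<close>

lemma subset_prob_restrict:
  assumes "finite V" "U \<subseteq> V"
  shows "subset_prob p V (\<lambda>I. X (I \<inter> U)) = subset_prob p U X"
proof -
  have "subset_prob p (U \<union> (V - U)) (\<lambda>I. X (I \<inter> U) \<and> True) =
      subset_prob p U X * subset_prob p (V - U) (\<lambda>_. True)"
    using assms by (intro subset_prob_indep) (auto intro: finite_subset)
  moreover have "U \<union> (V - U) = V" using assms(2) by blast
  ultimately show ?thesis using assms(1) by (simp add: subset_prob_True)
qed

lemma subset_prob_not_full:
  assumes "finite V"
  shows "subset_prob p V (\<lambda>I. \<not> V \<subseteq> I) = 1 - p ^ card V"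
proof -
  have "{I. I \<subseteq> V \<and> V \<subseteq> I} = {V}" by blast
  then have "subset_prob p V (\<lambda>I. V \<subseteq> I) = p ^ card V" by (simp add: subset_prob_def)
  with subset_prob_split[OF assms, of p "\<lambda>_. True" "\<lambda>I. V \<subseteq> I"] subset_prob_True[OF assms, of p]
  show ?thesis by simp
qed

text \<open>By independence on disjoint ground sets, each member of \<open>P\<close> splits off one
  factor.\<close>

lemma subset_prob_disjoint_family:
  assumes "finite P" "\<And>A. A \<in> P \<Longrightarrow> finite A" "pairwise disjnt P"
  shows "subset_prob p (\<Union>P) (\<lambda>I. \<forall>A\<in>P. \<not> A \<subseteq> I) = (\<Prod>A\<in>P. 1 - p ^ card A)"
  using assms
proof (induction P)
  case empty
  then show ?case using subset_prob_True[of "{}"] by simp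
next
  case (insert A P)
  have disj: "A \<inter> \<Union>P = {}"
    using insert.prems(2) insert.hyps(2) by (auto simp: pairwise_insert disjnt_def)
  have "subset_prob p (\<Union>(insert A P)) (\<lambda>I. \<forall>B\<in>insert A P. \<not> B \<subseteq> I) =
      subset_prob p (A \<union> \<Union>P) (\<lambda>I. \<not> A \<subseteq> I \<inter> A \<and> (\<forall>B\<in>P. \<not> B \<subseteq> I \<inter> \<Union>P))"
    unfolding Union_insert by (rule subset_prob_cong) auto
  also have "\<dots> = subset_prob p A (\<lambda>I. \<not> A \<subseteq> I) * subset_prob p (\<Union>P) (\<lambda>I. \<forall>B\<in>P. \<not> B \<subseteq> I)"
    using insert disj by (intro subset_prob_indep) auto
  finally show ?case
    using insert by (simp add: subset_prob_not_full pairwise_insert)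
qed

text \<open>The source of the exponentially small error when a sunflower is replaced by its core;
  \<open>P\<close> will consist of the petals.\<close>

lemma subset_prob_disjoint_family_le:
  assumes "0 \<le> p" "p \<le> 1" "finite V" "\<Union>P \<subseteq> V" "pairwise disjnt P" "\<And>A. A \<in> P \<Longrightarrow> card A \<le> k"
  shows "subset_prob p V (\<lambda>I. \<forall>A\<in>P. \<not> A \<subseteq> I) \<le> (1 - p ^ k) ^ card P"
proof -
  have fin: "finite P" "\<And>A. A \<in> P \<Longrightarrow> finite A"
    using assms(3,4) by (auto intro: finite_UnionD finite_subset)
  have "subset_prob p V (\<lambda>I. \<forall>A\<in>P. \<not> A \<subseteq> I) =
      subset_prob p V (\<lambda>I. \<forall>A\<in>P. \<not> A \<subseteq> I \<inter> \<Union>P)"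
    by (rule subset_prob_cong) auto
  also have "\<dots> = subset_prob p (\<Union>P) (\<lambda>I. \<forall>A\<in>P. \<not> A \<subseteq> I)"
    using assms(3,4) by (rule subset_prob_restrict)
  also have "\<dots> = (\<Prod>A\<in>P. 1 - p ^ card A)"
    using fin assms(5) by (rule subset_prob_disjoint_family)
  also have "\<dots> \<le> (\<Prod>A\<in>P. 1 - p ^ k)"
    using assms(1,2,6) by (intro prod_mono) (auto intro: power_decreasing power_le_one)
  finally show ?thesis by simp
qed

section \<open>Densities of set families\<close>

text \<open>Taking \<open>\<Union>F\<close> as ground set makes the density a function of the edges
  alone; by \<open>avoid_density_superset\<close>, isolated vertices do not change it.\<close>

definition avoid_density :: "real \<Rightarrow> 'a set set \<Rightarrow> real" where
  "avoid_density p F = subset_prob p (\<Union>F) (\<lambda>I. \<forall>E\<in>F. \<not> E \<subseteq> I)"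

lemma avoid_density_superset:
  assumes "finite V" "\<Union>F \<subseteq> V"
  shows "subset_prob p V (\<lambda>I. \<forall>E\<in>F. \<not> E \<subseteq> I) = avoid_density p F"
proof -
  have "subset_prob p V (\<lambda>I. \<forall>E\<in>F. \<not> E \<subseteq> I) = subset_prob p V (\<lambda>I. \<forall>E\<in>F. \<not> E \<subseteq> I \<inter> \<Union>F)"
    by (rule subset_prob_cong) auto
  also have "\<dots> = avoid_density p F"
    using subset_prob_restrict[OF assms, of p "\<lambda>I. \<forall>E\<in>F. \<not> E \<subseteq> I"] by (simp add: avoid_density_def)
  finally show ?thesis .
qed

lemma fin_indep_density_eq_avoid_density:
  assumes "finite_hypergraph H"
  shows "fin_indep_density p H = avoid_density p (edges H)"
proof -
  have "fin_indep_density p H = subset_prob p (verts H) (\<lambda>I. \<forall>E\<in>edges H. \<not> E \<subseteq> I)"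
    unfolding fin_indep_density_def subset_prob_def independent_def by simp
  also have "\<dots> = avoid_density p (edges H)"
    using assms by (intro avoid_density_superset) (auto simp: finite_hypergraph_def hypergraph_def)
  finally show ?thesis .
qed

text \<open>A set containing some edge of \<open>G\<close> also contains one of \<open>F\<close>, so
  avoiding \<open>F\<close> implies avoiding \<open>G\<close>. The two events are compared on the
  common ground set \<open>\<Union>F \<union> \<Union>G\<close>.\<close>

lemma avoid_density_antimono:
  assumes "0 \<le> p" "p \<le> 1" "finite (\<Union>F)" "finite (\<Union>G)" "\<And>E. E \<in> G \<Longrightarrow> \<exists>D\<in>F. D \<subseteq> E"
  shows "avoid_density p F \<le> avoid_density p G"
proof -
  have "subset_prob p (\<Union>F \<union> \<Union>G) (\<lambda>I. \<forall>E\<in>F. \<not> E \<subseteq> I) \<le>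
      subset_prob p (\<Union>F \<union> \<Union>G) (\<lambda>I. \<forall>E\<in>G. \<not> E \<subseteq> I)"
    using assms by (intro subset_prob_mono) (auto dest: subset_trans)
  then show ?thesis
    using assms(3,4) by (simp add: avoid_density_superset)
qed

text \<open>The last two hypotheses say that \<open>F\<close> and \<open>G\<close> have the same
  upward closure, which determines the density.\<close>

lemma avoid_density_eqI:
  assumes "0 \<le> p" "p \<le> 1" "finite (\<Union>F)" "finite (\<Union>G)"
    and "\<And>E. E \<in> G \<Longrightarrow> \<exists>D\<in>F. D \<subseteq> E" "\<And>E. E \<in> F \<Longrightarrow> \<exists>D\<in>G. D \<subseteq> E"
  shows "avoid_density p F = avoid_density p G"
  by (rule antisym; rule avoid_density_antimono; fact)

definition antichain :: "'a set set \<Rightarrow> bool" where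
  "antichain F \<longleftrightarrow> (\<forall>D\<in>F. \<forall>E\<in>F. D \<subseteq> E \<longrightarrow> D = E)"

text \<open>The inclusion-minimal edges generate the same upward closure as all edges. In an
  antichain, the core of a sunflower with two members contains no edge, so inserting it is a genuine
  change.\<close>

lemma antichain_same_density:
  assumes "0 \<le> p" "p \<le> 1" "finite (\<Union>F)"
  obtains G where "G \<subseteq> F" "antichain G" "avoid_density p G = avoid_density p F"
proof
  let ?G = "{E \<in> F. \<forall>D\<in>F. D \<subseteq> E \<longrightarrow> D = E}"
  show sub: "?G \<subseteq> F" by blast
  show "antichain ?G" unfolding antichain_def by blast
  have "finite F" using assms(3) by (rule finite_UnionD)
  have "\<exists>D\<in>?G. D \<subseteq> E" if E: "E \<in> F" for E
  proof -
    obtain D where "D \<in> F" "D \<subseteq> E" "\<And>D'. D' \<in> F \<Longrightarrow> D' \<subseteq> D \<Longrightarrow> D' = D"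
      using finite_has_minimal2[OF \<open>finite F\<close> E] by metis
    then show ?thesis by (intro bexI[of _ D]) simp_all
  qed
  moreover have "finite (\<Union>?G)" by (rule finite_subset[OF Union_mono[OF sub] assms(3)])
  moreover have "\<exists>D\<in>F. D \<subseteq> E" if "E \<in> ?G" for E using that by blast
  ultimately show "avoid_density p ?G = avoid_density p F"
    by (intro avoid_density_eqI assms)
qed

section \<open>Sunflowers\<close>

text \<open>\<open>S\<close> is the core and the sets \<open>A - S\<close> are the petals. A family
  with at most one member is a sunflower with any core, hence the bounds
  \<open>card P \<ge> 2\<close> below.\<close>

definition sunflower :: "'a set \<Rightarrow> 'a set set \<Rightarrow> bool" where
  "sunflower S P \<longleftrightarrow> pairwise (\<lambda>A B. A \<inter> B = S) P"

lemma sunflower_core_subset: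
  assumes "sunflower S P" "card P \<ge> 2" "A \<in> P"
  shows "S \<subseteq> A"
proof -
  have "\<not> P \<subseteq> {A}" using assms(2) card_mono[of "{A}" P] by auto
  then obtain B where "B \<in> P" "B \<noteq> A" by blast
  then have "A \<inter> B = S" using assms by (auto simp: sunflower_def pairwise_def)
  then show ?thesis by blast
qed

text \<open>Take \<open>D\<close> maximal under inclusion: an edge missing \<open>\<Union>D\<close>
  could be added to it. The empty edge meets nothing and is therefore excepted.\<close>

lemma maximal_disjoint_subfamily:
  assumes "finite F"
  obtains D where "D \<subseteq> F" "pairwise disjnt D" "\<And>E. E \<in> F \<Longrightarrow> E \<noteq> {} \<Longrightarrow> E \<inter> \<Union>D \<noteq> {}"
proof -
  have "finite {D. D \<subseteq> F \<and> pairwise disjnt D}" using assms by simp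
  moreover have "{} \<in> {D. D \<subseteq> F \<and> pairwise disjnt D}" by simp
  then have "{D. D \<subseteq> F \<and> pairwise disjnt D} \<noteq> {}" by blast
  ultimately obtain D where D: "D \<subseteq> F" "pairwise disjnt D"
    and max: "\<And>D'. D' \<subseteq> F \<Longrightarrow> pairwise disjnt D' \<Longrightarrow> D \<subseteq> D' \<Longrightarrow> D = D'"
    using finite_has_maximal[of "{D. D \<subseteq> F \<and> pairwise disjnt D}"]
    by (metis (no_types, lifting) mem_Collect_eq)
  have "E \<inter> \<Union>D \<noteq> {}" if "E \<in> F" "E \<noteq> {}" for E
  proof
    assume *: "E \<inter> \<Union>D = {}"
    then have "pairwise disjnt (insert E D)"
      using D(2) by (auto simp: pairwise_insert disjnt_def)
    then have "E \<in> D" using max[of "insert E D"] D(1) that(1) by blast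
    with * that(2) show False by blast
  qed
  with D that show ?thesis by blast
qed

text \<open>The Erdos-Rado sunflower lemma, by induction on the edge size. A maximal disjoint
  subfamily either has \<open>M\<close> members, giving a sunflower with empty core, or has a small
  union meeting every edge; then some vertex lies in many edges, and deleting it from them reduces
  their size.\<close>

lemma sunflower_lemma:
  "\<exists>N. \<forall>F :: 'a set set. finite F \<longrightarrow> (\<forall>E\<in>F. finite E \<and> card E = r) \<longrightarrow> N < card F \<longrightarrow>
     (\<exists>S P. P \<subseteq> F \<and> card P = M \<and> sunflower S P)"
proof (induction r)
  case 0
  \<comment> \<open>Only the empty set has size 0, so \<open>N = 1\<close> works vacuously.\<close>
  have "card F \<le> 1" if "\<forall>E\<in>F. finite E \<and> card E = 0" for F :: "'a set set"
    proof -
    have "F \<subseteq> {{}}" using that by auto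
    then show ?thesis using card_mono[of "{{}}" F] by simp
  qed
  then show ?case by (metis not_less)
next
  case (Suc r)
  then obtain N where N: "\<And>F :: 'a set set. finite F \<Longrightarrow> \<forall>E\<in>F. finite E \<and> card E = r \<Longrightarrow>
      N < card F \<Longrightarrow> \<exists>S P. P \<subseteq> F \<and> card P = M \<and> sunflower S P" by metis
  have "\<exists>S P. P \<subseteq> F \<and> card P = M \<and> sunflower S P"
    if fin: "finite F" and unif: "\<forall>E\<in>F. finite E \<and> card E = Suc r"
      and large: "M * Suc r * N < card F" for F :: "'a set set"
  proof -
    obtain D where D: "D \<subseteq> F" "pairwise disjnt D"
      and meets: "\<And>E. E \<in> F \<Longrightarrow> E \<noteq> {} \<Longrightarrow> E \<inter> \<Union>D \<noteq> {}"
      using maximal_disjoint_subfamily[OF fin] by metis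
    show ?thesis
    proof (cases "M \<le> card D")
      case True
      then obtain P where "P \<subseteq> D" "card P = M" by (metis obtain_subset_with_card_n)
      moreover have "sunflower {} P"
        using D(2) \<open>P \<subseteq> D\<close> unfolding sunflower_def disjnt_def by (rule pairwise_subset)
      ultimately show ?thesis using D(1) by blast
    next
      case False
      have finU: "finite (\<Union>D)" using D(1) fin unif by (auto intro: finite_subset)
      have "card (\<Union>D) \<le> (\<Sum>E\<in>D. card E)" by (rule card_Union_le_sum_card)
      also have "\<dots> = card D * Suc r" using D(1) unif by (simp add: subset_iff)
      also have "\<dots> \<le> M * Suc r" using False by (intro mult_right_mono) auto
      finally have cardU: "card (\<Union>D) \<le> M * Suc r" .
      \<comment> \<open>Pigeonhole: all edges are nonempty and meet \<open>\<Union>D\<close>, which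
        has at most \<open>M * Suc r\<close> vertices; with at most \<open>N\<close> edges through
        each there would be at most \<open>M * Suc r * N\<close> edges.\<close>
      have "\<exists>v\<in>\<Union>D. N < card {E \<in> F. v \<in> E}"
      proof (rule ccontr)
        assume "\<not> ?thesis"
        then have small: "\<And>v. v \<in> \<Union>D \<Longrightarrow> card {E \<in> F. v \<in> E} \<le> N" by force
        have "F \<subseteq> (\<Union>v\<in>\<Union>D. {E \<in> F. v \<in> E})" using meets unif by fastforce
        then have "card F \<le> card (\<Union>v\<in>\<Union>D. {E \<in> F. v \<in> E})"
          using fin by (intro card_mono) (auto intro: finite_subset[OF _ fin])
        also have "\<dots> \<le> (\<Sum>v\<in>\<Union>D. card {E \<in> F. v \<in> E})" using finU by (rule card_UN_le)
        also have "\<dots> \<le> (\<Sum>v\<in>\<Union>D. N)" using small by (rule sum_mono)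
        also have "\<dots> \<le> M * Suc r * N" using cardU by (simp del: mult_Suc_right)
        finally show False using large by simp
      qed
      then obtain v where v: "N < card {E \<in> F. v \<in> E}" by blast
      let ?G = "(\<lambda>E. E - {v}) ` {E \<in> F. v \<in> E}"
      have inj: "inj_on (\<lambda>E. E - {v}) {E \<in> F. v \<in> E}" by (auto simp: inj_on_def)
      have "N < card ?G" using v by (simp add: card_image[OF inj])
      moreover have "\<forall>E\<in>?G. finite E \<and> card E = r" using unif by auto
      ultimately obtain S P where P: "P \<subseteq> ?G" "card P = M" "sunflower S P"
        using N[of ?G] fin by auto
      \<comment> \<open>Members of \<open>P\<close> do not contain \<open>v\<close>, so putting
        \<open>v\<close> back is injective and only adds \<open>v\<close> to the core.\<close>
      have "insert v ` P \<subseteq> F" using P(1) by (auto simp: insert_absorb)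
      moreover have "inj_on (insert v) P" using P(1) by (intro inj_onI) blast
      then have "card (insert v ` P) = M" using P(2) by (simp add: card_image)
      moreover have "sunflower (insert v S) (insert v ` P)"
        using P(3) unfolding sunflower_def pairwise_def by blast
      ultimately show ?thesis by blast
    qed
  qed
  then show ?case by blast
qed

text \<open>Inserting \<open>S\<close> loses exactly the probability that the random set avoids
  \<open>F\<close> but contains \<open>S\<close>. Such a set contains no petal \<open>A - S\<close>,
  and the petals are disjoint and of size at most \<open>k\<close>.\<close>

lemma avoid_density_insert_core:
  assumes "0 \<le> p" "p \<le> 1" "finite (\<Union>F)" "\<And>E. E \<in> F \<Longrightarrow> card E \<le> k"
    and "P \<subseteq> F" "sunflower S P" "card P \<ge> 2"
  shows "\<bar>avoid_density p (insert S F) - avoid_density p F\<bar> \<le> (1 - p ^ k) ^ card P"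
proof -
  have core: "S \<subseteq> A" if "A \<in> P" for A
    using assms(6,7) that by (rule sunflower_core_subset)
  \<comment> \<open>The core lies inside an edge, so inserting it adds no vertex to the ground
    set.\<close>
  obtain A where "A \<in> P" using assms(7) by fastforce
  then have sub: "S \<subseteq> \<Union>F" using core assms(5) by blast
  have fin: "finite E" if "E \<in> F" for E using that assms(3) by (auto intro: finite_subset)
  let ?Q = "(\<lambda>A. A - S) ` P"
  have "inj_on (\<lambda>A. A - S) P" using core by (intro inj_onI) blast
  then have card: "card ?Q = card P" by (rule card_image)
  have disj: "pairwise disjnt ?Q"
    using assms(6) unfolding sunflower_def pairwise_def disjnt_def by blast
  have small: "card A \<le> k" if "A \<in> ?Q" for A
    using that assms(4,5) fin by (auto intro!: order_trans[OF card_mono[OF _ Diff_subset]])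
  let ?X = "\<lambda>I. \<forall>E\<in>F. \<not> E \<subseteq> I"
  have "subset_prob p (\<Union>F) (\<lambda>I. ?X I \<and> S \<subseteq> I) \<le> subset_prob p (\<Union>F) (\<lambda>I. \<forall>A\<in>?Q. \<not> A \<subseteq> I)"
    using assms(1-3,5) by (intro subset_prob_mono) blast+
  also have "\<dots> \<le> (1 - p ^ k) ^ card P"
    unfolding card[symmetric] using assms(1-3,5) disj small
    by (intro subset_prob_disjoint_family_le) auto
  finally have "subset_prob p (\<Union>F) (\<lambda>I. ?X I \<and> S \<subseteq> I) \<le> (1 - p ^ k) ^ card P" .
  moreover have "subset_prob p (\<Union>F) (\<lambda>I. ?X I \<and> \<not> S \<subseteq> I) = avoid_density p (insert S F)"
  proof -
    have "subset_prob p (\<Union>F) (\<lambda>I. ?X I \<and> \<not> S \<subseteq> I) =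
        subset_prob p (\<Union>F) (\<lambda>I. \<forall>E\<in>insert S F. \<not> E \<subseteq> I)"
      by (rule subset_prob_cong) auto
    then show ?thesis using avoid_density_superset[OF assms(3), of "insert S F" p] sub by simp
  qed
  moreover have "0 \<le> subset_prob p (\<Union>F) (\<lambda>I. ?X I \<and> S \<subseteq> I)"
    using assms(1,2) by (rule subset_prob_nonneg)
  ultimately show ?thesis
    using subset_prob_split[OF assms(3), of p ?X "\<lambda>I. S \<subseteq> I"] by (simp add: avoid_density_def)
qed

section \<open>Closedness of the set of finite densities\<close>

definition edge_count :: "'a set set \<Rightarrow> nat \<Rightarrow> nat" where
  "edge_count F i = card {E \<in> F. card E = i}"

text \<open>The normal form of a finite hypergraph of rank at most \<open>k\<close>. Finiteness of
  the union makes both the edges and their number finite.\<close>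

definition rank_antichain :: "nat \<Rightarrow> 'a set set \<Rightarrow> bool" where
  "rank_antichain k F \<longleftrightarrow> finite (\<Union>F) \<and> antichain F \<and> (\<forall>E\<in>F. card E \<le> k)"

text \<open>Insert the core and delete the edges containing it. All deleted edges are larger than
  \<open>S\<close>, so the vector of edge counts keeps its entries below \<open>card S\<close> and
  gains 1 at \<open>card S\<close>: it increases lexicographically.\<close>

lemma rank_antichain_core_exchange:
  fixes F :: "'a set set"
  assumes p: "0 \<le> p" "p \<le> 1" and F: "rank_antichain k F"
    and P: "P \<subseteq> F" "sunflower S P" "card P \<ge> 2" "\<And>E. E \<in> P \<Longrightarrow> card E = j"
  obtains G :: "'a set set" where "rank_antichain k G" "card S < j"
    "\<bar>avoid_density p G - avoid_density p F\<bar> \<le> (1 - p ^ k) ^ card P"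
    "\<And>i. i < card S \<Longrightarrow> edge_count G i = edge_count F i"
    "edge_count F (card S) < edge_count G (card S)"
proof -
  have finF: "finite F" "\<And>E. E \<in> F \<Longrightarrow> finite E"
    using F by (auto simp: rank_antichain_def intro: finite_UnionD finite_subset)
  have anti: "\<And>D E. D \<in> F \<Longrightarrow> E \<in> F \<Longrightarrow> D \<subseteq> E \<Longrightarrow> D = E"
    using F by (auto simp: rank_antichain_def antichain_def)
  obtain A where A: "A \<in> P" using P(3) by fastforce
  \<comment> \<open>A second member makes the core a proper subset of \<open>A\<close>:
    \<open>S = A\<close> would give \<open>A \<subseteq> B\<close>, impossible in an
    antichain.\<close>
  have "\<not> P \<subseteq> {A}" using P(3) card_mono[of "{A}" P] by auto
  then obtain B where B: "B \<in> P" "B \<noteq> A" by blast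
  have "S \<subseteq> A" using sunflower_core_subset[OF P(2,3) A] .
  moreover have "A \<inter> B = S" using P(2) A B by (auto simp: sunflower_def pairwise_def)
  moreover have "\<not> A \<subseteq> B" using A B P(1) anti by blast
  ultimately have SA: "S \<subset> A" by blast
  have finA: "finite A" using A P(1) finF by blast
  have SJ: "card S < j" using psubset_card_mono[OF finA SA] P(4)[OF A] by simp
  have AF: "A \<in> F" using A P(1) by blast
  have noSub: "\<not> E \<subseteq> S" if "E \<in> F" for E using anti[OF that AF] SA by blast
  let ?G = "insert S {E \<in> F. \<not> S \<subseteq> E}"
  have finS: "finite S" using SA finA by (auto intro: finite_subset)
  have "antichain ?G" using anti noSub unfolding antichain_def by blast
  moreover have "card S \<le> k"
    using SJ P(4)[OF A] AF F by (auto simp: rank_antichain_def)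
  moreover have fUG: "finite (\<Union>?G)" using finF finS by auto
  ultimately have antiG: "rank_antichain k ?G"
    using F by (auto simp: rank_antichain_def)
  \<comment> \<open>The deleted edges contain \<open>S\<close>, so deleting them preserves the
    upward closure.\<close>
  have "avoid_density p ?G = avoid_density p (insert S F)"
    using p fUG finF finS by (intro avoid_density_eqI) auto
  then have close: "\<bar>avoid_density p ?G - avoid_density p F\<bar> \<le> (1 - p ^ k) ^ card P"
    using avoid_density_insert_core[OF p _ _ P(1-3), of k] F by (simp add: rank_antichain_def)
  have small: "\<not> S \<subseteq> E" if "E \<in> F" "card E \<le> card S" for E
    using that noSub finF by (metis card_seteq order_refl)
  have same: "edge_count ?G i = edge_count F i" if "i < card S" for i
  proof -
    have "{E \<in> ?G. card E = i} = {E \<in> F. card E = i}" using that small by auto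
    then show ?thesis by (simp add: edge_count_def)
  qed
  have "{E \<in> ?G. card E = card S} = insert S {E \<in> F. card E = card S}" using small by auto
  moreover have "S \<notin> F" using noSub by blast
  ultimately have "edge_count F (card S) < edge_count ?G (card S)"
    using finF(1) by (simp add: edge_count_def)
  with antiG SJ close same show ?thesis using that by blast
qed

text \<open>\<open>x\<close> lies in the closure of the densities of the families satisfying
  \<open>Q\<close>.\<close>

definition approachable :: "real \<Rightarrow> nat \<Rightarrow> real \<Rightarrow> ('a set set \<Rightarrow> bool) \<Rightarrow> bool" where
  "approachable p k x Q \<longleftrightarrow>
     (\<forall>\<epsilon>>0. \<exists>F. rank_antichain k F \<and> Q F \<and> \<bar>avoid_density p F - x\<bar> < \<epsilon>)"

definition agrees_below :: "nat \<Rightarrow> (nat \<Rightarrow> nat) \<Rightarrow> 'a set set \<Rightarrow> bool" where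
  "agrees_below j s F \<longleftrightarrow> (\<forall>i<j. edge_count F i = s i)"

text \<open>Otherwise families near \<open>x\<close> have so many edges of size \<open>j\<close>
  that these contain a huge sunflower. The core exchange then gives a family still near
  \<open>x\<close>, with the prescribed entries below \<open>card S < j\<close> and a larger entry
  at \<open>card S\<close>, against the maximality of the earlier entries.\<close>

lemma edge_count_bounded_near:
  assumes p: "0 < p" "p \<le> 1"
    and max: "\<And>i. i < j \<Longrightarrow>
      \<not> approachable p k x (\<lambda>F :: 'a set set. agrees_below i s F \<and> s i < edge_count F i)"
  shows "\<exists>N. \<not> approachable p k x (\<lambda>F :: 'a set set. agrees_below j s F \<and> N < edge_count F j)"
proof -
  have "\<forall>i\<in>{..<j}. \<exists>\<epsilon>>0. \<forall>F :: 'a set set. rank_antichain k F \<longrightarrow> agrees_below i s F \<longrightarrow>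
      s i < edge_count F i \<longrightarrow> \<epsilon> \<le> \<bar>avoid_density p F - x\<bar>"
    using max unfolding approachable_def by (force simp: not_less)
  then obtain \<epsilon> where \<epsilon>: "\<And>i. i < j \<Longrightarrow> 0 < \<epsilon> i" "\<And>i F. i < j \<Longrightarrow> rank_antichain k (F :: 'a set set) \<Longrightarrow>
      agrees_below i s F \<Longrightarrow> s i < edge_count F i \<Longrightarrow> \<epsilon> i \<le> \<bar>avoid_density p F - x\<bar>"
    unfolding bchoice_iff by auto
  \<comment> \<open>Half of the smallest \<open>\<epsilon> i\<close>: one \<open>\<delta>\<close> is
    spent on the distance of \<open>F\<close> from \<open>x\<close>, one on the exchange. The extra
    1 keeps the set nonempty when \<open>j = 0\<close>.\<close>
  define \<delta> where "\<delta> = Min (insert 1 (\<epsilon> ` {..<j})) / 2"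
  have \<delta>: "0 < \<delta>" "\<And>i. i < j \<Longrightarrow> 2 * \<delta> \<le> \<epsilon> i"
    using \<epsilon>(1) by (auto simp: \<delta>_def Min_gr_iff)
  have q: "0 \<le> 1 - p ^ k" "1 - p ^ k < 1" using p by (auto simp: power_le_one)
  \<comment> \<open>\<open>M0\<close> petals make the error small, but the exchange requires at
    least two, hence \<open>max 2 M0\<close>.\<close>
  obtain M0 where "(1 - p ^ k) ^ M0 < \<delta>" using real_arch_pow_inv[OF \<delta>(1) q(2)] by blast
  then have M: "(1 - p ^ k) ^ max 2 M0 < \<delta>"
    using power_decreasing[of M0 "max 2 M0" "1 - p ^ k"] q by simp
  obtain N where N: "\<And>F :: 'a set set. finite F \<Longrightarrow> \<forall>E\<in>F. finite E \<and> card E = j \<Longrightarrow>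
      N < card F \<Longrightarrow> \<exists>S P. P \<subseteq> F \<and> card P = max 2 M0 \<and> sunflower S P"
    using sunflower_lemma[of j "max 2 M0"] by metis
  have "\<not> \<bar>avoid_density p F - x\<bar> < \<delta>"
    if F: "rank_antichain k F" "agrees_below j s F" "N < edge_count F j" for F :: "'a set set"
  proof
    assume close: "\<bar>avoid_density p F - x\<bar> < \<delta>"
    have "finite F" "\<And>E. E \<in> F \<Longrightarrow> finite E"
      using F(1) by (auto simp: rank_antichain_def intro: finite_UnionD finite_subset)
    then have "\<exists>S P. P \<subseteq> {E \<in> F. card E = j} \<and> card P = max 2 M0 \<and> sunflower S P"
      using F(3) by (intro N) (simp_all add: edge_count_def)
    then obtain S P where P: "P \<subseteq> {E \<in> F. card E = j}" "card P = max 2 M0" "sunflower S P"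
      by blast
    have P': "P \<subseteq> F" "2 \<le> card P" "\<And>E. E \<in> P \<Longrightarrow> card E = j"
      using P(1,2) by auto
    obtain G :: "'a set set" where G: "rank_antichain k G" "card S < j"
      "\<bar>avoid_density p G - avoid_density p F\<bar> \<le> (1 - p ^ k) ^ card P"
      "\<And>i. i < card S \<Longrightarrow> edge_count G i = edge_count F i"
      "edge_count F (card S) < edge_count G (card S)"
      using rank_antichain_core_exchange[OF less_imp_le[OF p(1)] p(2) F(1) P'(1) P(3) P'(2,3)] by metis
    have "agrees_below (card S) s G" "s (card S) = edge_count F (card S)"
      using F(2) G(2,4) by (simp_all add: agrees_below_def)
    then have "\<epsilon> (card S) \<le> \<bar>avoid_density p G - x\<bar>"
      using \<epsilon>(2)[OF G(2,1)] G(5) by simp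
    moreover have "\<bar>avoid_density p G - x\<bar> < 2 * \<delta>" using G(3) close M unfolding P(2) by linarith
    ultimately show False using \<delta>(2)[OF G(2)] by linarith
  qed
  then show ?thesis using \<delta>(1) unfolding approachable_def by blast
qed

text \<open>The lexicographic maximum is built greedily: once the first \<open>j\<close> entries are
  maximal, entry \<open>j\<close> is bounded near \<open>x\<close> and its largest value approached
  there is chosen.\<close>

lemma maximal_profile:
  assumes p: "0 < p" "p \<le> 1" and x: "approachable p k x (\<lambda>F :: 'a set set. True)"
  shows "\<exists>s. approachable p k x (agrees_below j s :: 'a set set \<Rightarrow> bool) \<and>
    (\<forall>i<j. \<not> approachable p k x (\<lambda>F :: 'a set set. agrees_below i s F \<and> s i < edge_count F i))"
proof (induction j)
  case 0
  then show ?case using x by (simp add: approachable_def agrees_below_def)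
next
  case (Suc j)
  then obtain s where s: "approachable p k x (agrees_below j s :: 'a set set \<Rightarrow> bool)"
    and max: "\<And>i. i < j \<Longrightarrow>
      \<not> approachable p k x (\<lambda>F :: 'a set set. agrees_below i s F \<and> s i < edge_count F i)"
    by blast
  let ?Q = "\<lambda>N. approachable p k x (\<lambda>F :: 'a set set. agrees_below j s F \<and> N < edge_count F j)"
  \<comment> \<open>Entry \<open>j\<close> exceeds every \<open>N < m\<close> arbitrarily close to
    \<open>x\<close>, but does not exceed \<open>m\<close> there, so \<open>m\<close> is the wanted
    maximum.\<close>
  define m where "m = (LEAST N. \<not> ?Q N)"
  have "\<exists>N. \<not> ?Q N" using p max by (rule edge_count_bounded_near)
  then have m: "\<not> ?Q m" unfolding m_def by (rule LeastI_ex)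
  have least: "?Q N" if "N < m" for N using not_less_Least[OF that[unfolded m_def]] by blast
  have ge: "approachable p k x (\<lambda>F :: 'a set set. agrees_below j s F \<and> m \<le> edge_count F j)"
  proof (cases m)
    case 0
    then show ?thesis using s by simp
  next
    case (Suc N)
    then show ?thesis using least[of N] by (simp add: Suc_le_eq)
  qed
  \<comment> \<open>Within \<open>\<delta>\<close> of \<open>x\<close> the entry is at most
    \<open>m\<close>; combined with \<open>ge\<close> this forces equality.\<close>
  obtain \<delta> where \<delta>: "\<delta> > 0" "\<And>F :: 'a set set. rank_antichain k F \<Longrightarrow> agrees_below j s F \<Longrightarrow>
      \<bar>avoid_density p F - x\<bar> < \<delta> \<Longrightarrow> edge_count F j \<le> m"
    using m unfolding approachable_def by (metis not_less)
  have eq: "agrees_below (Suc j) (s(j := m)) F \<longleftrightarrow> agrees_below j s F \<and> edge_count F j = m"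
    for F :: "'a set set"
    unfolding agrees_below_def by (auto simp: less_Suc_eq)
  have le: "agrees_below i (s(j := m)) F \<longleftrightarrow> agrees_below i s F" if "i \<le> j" for i and F :: "'a set set"
    using that unfolding agrees_below_def by auto
  have "approachable p k x (agrees_below (Suc j) (s(j := m)) :: 'a set set \<Rightarrow> bool)"
    unfolding approachable_def eq
  proof (intro allI impI)
    fix \<epsilon> :: real assume "\<epsilon> > 0"
    with \<delta>(1) have "min \<epsilon> \<delta> > 0" by simp
    then obtain F :: "'a set set" where F: "rank_antichain k F" "agrees_below j s F" "m \<le> edge_count F j"
      "\<bar>avoid_density p F - x\<bar> < min \<epsilon> \<delta>"
      using ge unfolding approachable_def by blast
    then have "edge_count F j \<le> m" by (intro \<delta>(2)) auto
    with F show "\<exists>F :: 'a set set. rank_antichain k F \<and> (agrees_below j s F \<and> edge_count F j = m) \<and>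
        \<bar>avoid_density p F - x\<bar> < \<epsilon>" by (intro exI[of _ F]) auto
  qed
  moreover have "\<not> approachable p k x (\<lambda>F :: 'a set set. agrees_below i (s(j := m)) F \<and>
      (s(j := m)) i < edge_count F i)" if "i < Suc j" for i
    using that m max[of i] by (cases "i = j") (auto simp: le)
  ultimately show ?case by blast
qed

section \<open>Densities of families with a bounded number of edges\<close>

lemma avoid_density_relabel:
  assumes "finite (\<Union>F)" "inj_on f (\<Union>F)"
  shows "avoid_density p ((`) f ` F) = avoid_density p F"
proof -
  let ?H = "\<lparr>verts = \<Union>F, edges = F\<rparr>"
  have H: "finite_hypergraph ?H"
    using assms(1) by (auto simp: finite_hypergraph_def hypergraph_def intro: finite_subset)
  then have "finite_hypergraph (relabel f ?H)"
    by (auto simp: finite_hypergraph_def hypergraph_relabel)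
  with H assms(2) show ?thesis
    using fin_indep_density_relabel[of ?H f p]
    by (simp add: fin_indep_density_eq_avoid_density finite_hypergraph_def)
qed

text \<open>At most \<open>n\<close> edges of size at most \<open>k\<close> cover at most
  \<open>n * k\<close> vertices, so up to relabelling there are only finitely many families.\<close>

lemma finite_bounded_densities:
  "finite (avoid_density p ` {F :: 'a set set. rank_antichain k F \<and> card F \<le> n})"
proof (rule finite_subset)
  show "finite (avoid_density p ` Pow (Pow {..<n * k}))" by simp
  show "avoid_density p ` {F :: 'a set set. rank_antichain k F \<and> card F \<le> n} \<subseteq>
      avoid_density p ` Pow (Pow {..<n * k})"
  proof clarify
    fix F :: "'a set set" assume F: "rank_antichain k F" "card F \<le> n"
    then have fin: "finite (\<Union>F)" and "\<And>E. E \<in> F \<Longrightarrow> card E \<le> k"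
      by (auto simp: rank_antichain_def)
    then have "(\<Sum>E\<in>F. card E) \<le> card F * k" using sum_bounded_above[of F card k] by simp
    also have "\<dots> \<le> n * k" using F(2) by simp
    finally have card: "card (\<Union>F) \<le> n * k" using card_Union_le_sum_card[of F] by simp
    obtain f where f: "bij_betw f (\<Union>F) {0..<card (\<Union>F)}"
      using ex_bij_betw_finite_nat[OF fin] by blast
    then have "inj_on f (\<Union>F)" "f ` \<Union>F \<subseteq> {..<n * k}" using card by (auto simp: bij_betw_def)
    then have "avoid_density p F = avoid_density p ((`) f ` F)" "(`) f ` F \<in> Pow (Pow {..<n * k})"
      by (auto simp: avoid_density_relabel[OF fin])
    then show "avoid_density p F \<in> avoid_density p ` Pow (Pow {..<n * k})" by (rule image_eqI)
  qed
qed

lemma card_eq_sum_edge_count: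
  assumes "rank_antichain k F"
  shows "card F = (\<Sum>i\<le>k. edge_count F i)"
proof -
  have "finite F" "card ` F \<subseteq> {..k}"
    using assms by (auto simp: rank_antichain_def intro: finite_UnionD)
  then have "(\<Sum>i\<le>k. \<Sum>E | E \<in> F \<and> card E = i. 1) = (\<Sum>E\<in>F. 1 :: nat)"
    by (intro sum.group) auto
  then show ?thesis by (simp add: edge_count_def)
qed

text \<open>A profile of length \<open>Suc k\<close> prescribes the counts of all sizes from 0 to
  \<open>k\<close>, hence the total number of edges. The approximating densities then form a finite,
  thus closed, set, which must contain \<open>x\<close>.\<close>

lemma approachable_density:
  assumes p: "0 < p" "p \<le> 1" and x: "approachable p k x (\<lambda>F :: 'a set set. True)"
  shows "\<exists>F :: 'a set set. rank_antichain k F \<and> avoid_density p F = x"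
proof -
  obtain s where s: "approachable p k x (agrees_below (Suc k) s :: 'a set set \<Rightarrow> bool)"
    using maximal_profile[OF assms] by blast
  let ?X = "avoid_density p ` {F :: 'a set set. rank_antichain k F \<and> card F \<le> (\<Sum>i\<le>k. s i)}"
  have "x \<in> ?X"
  proof (rule ccontr)
    assume "x \<notin> ?X"
    moreover have "open (- ?X)" by (intro open_Compl finite_imp_closed finite_bounded_densities)
    ultimately have "\<exists>d>0. \<forall>y. dist y x < d \<longrightarrow> y \<in> - ?X" unfolding open_dist by blast
    then obtain d where d: "d > 0" "\<And>y. dist y x < d \<Longrightarrow> y \<notin> ?X" unfolding Compl_iff by metis
    obtain F :: "'a set set" where F: "rank_antichain k F" "agrees_below (Suc k) s F"
      "\<bar>avoid_density p F - x\<bar> < d"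
      using s d(1) unfolding approachable_def by blast
    have "card F = (\<Sum>i\<le>k. s i)"
      using F(2) card_eq_sum_edge_count[OF F(1)] by (simp add: agrees_below_def)
    then have "avoid_density p F \<in> ?X" using F(1) by simp
    with d(2) F(3) show False by (simp add: dist_real_def)
  qed
  then show ?thesis by auto
qed

section \<open>From antichains back to finite hypergraphs\<close>

lemma rank_le_iff: "rank H \<le> enat k \<longleftrightarrow> (\<forall>E\<in>edges H. card E \<le> k)"
  by (simp add: rank_def SUP_le_iff)

definition fin_densities :: "'a itself \<Rightarrow> nat \<Rightarrow> real \<Rightarrow> real set" where
  "fin_densities T k p = {fin_indep_density p H | H :: 'a hypergraph. finite_hypergraph H \<and> rank H \<le> enat k}"

lemma fin_densities_eq:
  assumes "0 \<le> p" "p \<le> 1"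
  shows "fin_densities TYPE('a) k p = avoid_density p ` {F :: 'a set set. rank_antichain k F}"
proof (intro equalityI subsetI)
  fix y assume "y \<in> fin_densities TYPE('a) k p"
  then obtain H :: "'a hypergraph" where H: "finite_hypergraph H" "rank H \<le> enat k"
    and y: "y = avoid_density p (edges H)"
    unfolding fin_densities_def by (auto simp: fin_indep_density_eq_avoid_density)
  have fin: "finite (\<Union>(edges H))"
    by (rule finite_subset[of _ "verts H"]) (use H in \<open>auto simp: finite_hypergraph_def hypergraph_def\<close>)
  obtain G where G: "G \<subseteq> edges H" "antichain G" "avoid_density p G = avoid_density p (edges H)"
    using antichain_same_density[OF assms fin] by blast
  then have "rank_antichain k G"
    using H(2) fin by (auto simp: rank_antichain_def rank_le_iff intro: finite_subset[OF Union_mono])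
  then show "y \<in> avoid_density p ` {F :: 'a set set. rank_antichain k F}"
    unfolding y G(3)[symmetric] by (intro imageI CollectI)
next
  fix y assume "y \<in> avoid_density p ` {F :: 'a set set. rank_antichain k F}"
  then obtain F :: "'a set set" where F: "rank_antichain k F" and y: "y = avoid_density p F" by blast
  let ?H = "\<lparr>verts = \<Union>F, edges = F\<rparr>"
  have "finite_hypergraph ?H" "rank ?H \<le> enat k"
    using F by (auto simp: finite_hypergraph_def hypergraph_def rank_antichain_def rank_le_iff
        intro: finite_subset)
  then show "y \<in> fin_densities TYPE('a) k p"
    unfolding fin_densities_def y
    by (auto simp: fin_indep_density_eq_avoid_density intro!: exI[of _ ?H])
qed

text \<open>Closedness in the form that serves both for the topological statement and for limits
  along chains.\<close>

lemma fin_densities_approachable: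
  assumes "0 < p" "p \<le> 1" "\<And>\<epsilon>. \<epsilon> > 0 \<Longrightarrow> \<exists>y\<in>fin_densities TYPE('a) k p. \<bar>y - x\<bar> < \<epsilon>"
  shows "x \<in> fin_densities TYPE('a) k p"
proof -
  have "approachable p k x (\<lambda>F :: 'a set set. True)"
    using assms(1,2) assms(3)[unfolded fin_densities_eq[OF less_imp_le[OF assms(1)] assms(2)]]
    by (auto simp: approachable_def)
  from approachable_density[OF assms(1,2) this] show ?thesis
    using assms(1,2) by (auto simp: fin_densities_eq)
qed

lemma closed_fin_densities:
  assumes "0 < p" "p \<le> 1"
  shows "closed (fin_densities TYPE('a) k p)"
  unfolding closed_def open_dist
proof (intro ballI)
  fix x assume "x \<in> - fin_densities TYPE('a) k p"
  then obtain \<epsilon> where "\<epsilon> > 0" "\<not> (\<exists>y\<in>fin_densities TYPE('a) k p. \<bar>y - x\<bar> < \<epsilon>)"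
    using fin_densities_approachable[OF assms, where 'a = 'a and k = k and x = x] by blast
  then show "\<exists>\<epsilon>>0. \<forall>y. dist y x < \<epsilon> \<longrightarrow> y \<in> - fin_densities TYPE('a) k p"
    unfolding dist_real_def Compl_iff by blast
qed

section \<open>Chains\<close>

lemma fin_indep_density_antimono:
  assumes "0 \<le> p" "p \<le> 1" "finite_hypergraph G" "finite_hypergraph H" "edges G \<subseteq> edges H"
  shows "fin_indep_density p H \<le> fin_indep_density p G"
proof -
  have "finite (\<Union>(edges K))" if "finite_hypergraph K" for K :: "'a hypergraph"
    by (rule finite_subset[of _ "verts K"]) (use that in \<open>auto simp: finite_hypergraph_def hypergraph_def\<close>)
  from this[OF assms(4)] this[OF assms(3)] show ?thesis
    unfolding fin_indep_density_eq_avoid_density[OF assms(3)]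
      fin_indep_density_eq_avoid_density[OF assms(4)]
    by (rule avoid_density_antimono[OF assms(1,2)]) (use assms(5) in blast)
qed

lemma hchain_edges_mono:
  assumes "hchain C H" "m \<le> n"
  shows "edges (C m) \<subseteq> edges (C n)"
proof -
  have "edges (C i) \<subseteq> edges (C (Suc i))" for i
  proof -
    have "induced_subhypergraph (C i) (C (Suc i))" using assms(1) by (simp add: hchain_def)
    then have "edges (C i) = {E \<in> edges (C (Suc i)). E \<subseteq> verts (C i)}"
      unfolding induced_subhypergraph_def ..
    then show ?thesis by blast
  qed
  then show ?thesis using assms(2) by (rule lift_Suc_mono_le)
qed

text \<open>Each of the finitely many edges of \<open>C n\<close> occurs in some member of
  \<open>C'\<close>; as the edge sets of \<open>C'\<close> increase, the largest index serves for
  all of them.\<close>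

lemma hchain_edges_cofinal:
  assumes "hchain C H" "hchain C' H"
  shows "\<exists>m. edges (C n) \<subseteq> edges (C' m)"
proof -
  have "finite (verts (C n))" "edges (C n) \<subseteq> Pow (verts (C n))"
    using assms(1) by (auto simp: hchain_def finite_hypergraph_def hypergraph_def)
  then have fin: "finite (edges (C n))" by (auto intro: finite_subset)
  have "edges (C n) \<subseteq> (\<Union>m. edges (C' m))"
    using assms by (auto simp: hchain_def)
  then have "\<forall>E\<in>edges (C n). \<exists>m. E \<in> edges (C' m)" by blast
  then obtain f where f: "\<And>E. E \<in> edges (C n) \<Longrightarrow> E \<in> edges (C' (f E))" by metis
  \<comment> \<open>If \<open>C n\<close> has no edges, \<open>Max\<close> of the empty set is
    unspecified, but then there is no edge to check.\<close>
  have "E \<in> edges (C' (Max (f ` edges (C n))))" if "E \<in> edges (C n)" for E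
  proof -
    have "f E \<le> Max (f ` edges (C n))" using fin that by simp
    then show ?thesis using f[OF that] hchain_edges_mono[OF assms(2)] by blast
  qed
  then show ?thesis by blast
qed

text \<open>Edge sets grow along a chain, so the densities decrease and are bounded below by
  0.\<close>

lemma hchain_convergent:
  assumes "0 \<le> p" "p \<le> 1" "hchain C H"
  obtains L where "(\<lambda>n. fin_indep_density p (C n)) \<longlonglongrightarrow> L" "\<And>n. L \<le> fin_indep_density p (C n)"
proof -
  have fin: "finite_hypergraph (C n)" for n using assms(3) by (simp add: hchain_def)
  have "decseq (\<lambda>n. fin_indep_density p (C n))"
    unfolding decseq_def using assms(1,2) fin hchain_edges_mono[OF assms(3)]
    by (intro allI impI fin_indep_density_antimono)
  moreover have "0 \<le> fin_indep_density p (C n)" for n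
    unfolding fin_indep_density_eq_avoid_density[OF fin] avoid_density_def
    using assms(1,2) by (rule subset_prob_nonneg)
  ultimately show ?thesis using that by (metis decseq_convergent)
qed

text \<open>The edges of each member of one chain lie in some member of the other, so each of the
  two limits is at most the other.\<close>

lemma hchain_limit_unique:
  assumes p: "0 \<le> p" "p \<le> 1" and C: "hchain C H" "(\<lambda>n. fin_indep_density p (C n)) \<longlonglongrightarrow> L"
    and C': "hchain C' H"
  shows "(\<lambda>n. fin_indep_density p (C' n)) \<longlonglongrightarrow> L"
proof -
  have le: "K' \<le> K" if D: "hchain D H" "(\<lambda>n. fin_indep_density p (D n)) \<longlonglongrightarrow> K"
    and D': "hchain D' H" "\<And>n. K' \<le> fin_indep_density p (D' n)" for D D' K K'
  proof (rule LIMSEQ_le_const[OF D(2)], intro exI allI impI)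
    fix n
    obtain m where "edges (D n) \<subseteq> edges (D' m)" using hchain_edges_cofinal[OF D(1) D'(1)] by blast
    then have "fin_indep_density p (D' m) \<le> fin_indep_density p (D n)"
      using p D(1) D'(1) by (intro fin_indep_density_antimono) (auto simp: hchain_def)
    with D'(2)[of m] show "K' \<le> fin_indep_density p (D n)" by simp
  qed
  obtain K where K: "(\<lambda>n. fin_indep_density p (C n)) \<longlonglongrightarrow> K" "\<And>n. K \<le> fin_indep_density p (C n)"
    using hchain_convergent[OF p C(1)] by blast
  then have "K = L" using C(2) LIMSEQ_unique by blast
  obtain L' where L': "(\<lambda>n. fin_indep_density p (C' n)) \<longlonglongrightarrow> L'" "\<And>n. L' \<le> fin_indep_density p (C' n)"
    using hchain_convergent[OF p C'] by blast
  have "L' = L"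
    using le[OF C C' L'(2)] le[OF C' L'(1) C(1) K(2)] \<open>K = L\<close> by simp
  with L'(1) show ?thesis by simp
qed

text \<open>All chains share the limit of \<open>C\<close>; the existence of the chain
  \<open>C\<close> is what makes the value in the definite description unique.\<close>

lemma indep_density_eq_limit:
  assumes "0 \<le> p" "p \<le> 1" "hchain C H" "(\<lambda>n. fin_indep_density p (C n)) \<longlonglongrightarrow> L"
  shows "indep_density p H = L"
  unfolding indep_density_def
proof (rule the_equality)
  show "\<forall>C. hchain C H \<longrightarrow> (\<lambda>n. fin_indep_density p (C n)) \<longlonglongrightarrow> L"
    using hchain_limit_unique[OF assms] by blast
next
  fix K assume "\<forall>C. hchain C H \<longrightarrow> (\<lambda>n. fin_indep_density p (C n)) \<longlonglongrightarrow> K"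
  then have "(\<lambda>n. fin_indep_density p (C n)) \<longlonglongrightarrow> K" using assms(3) by blast
  then show "K = L" using assms(4) by (rule LIMSEQ_unique)
qed

lemma indep_density_finite:
  assumes "0 \<le> p" "p \<le> 1" "finite_hypergraph H"
  shows "indep_density p H = fin_indep_density p H"
proof (rule indep_density_eq_limit[OF assms(1,2)])
  show "hchain (\<lambda>_. H) H"
    using assms(3) by (auto simp: hchain_def induced_subhypergraph_def finite_hypergraph_def hypergraph_def)
qed simp

text \<open>Enumerate the vertices and take the subhypergraphs induced on initial segments; a finite
  edge lies in one of them.\<close>

lemma hchain_exists:
  assumes "countable_hypergraph H"
  obtains C where "hchain C H"
proof
  let ?V = "\<lambda>n. {v \<in> verts H. to_nat_on (verts H) v < n}"
  let ?C = "\<lambda>n. \<lparr>verts = ?V n, edges = {E \<in> edges H. E \<subseteq> ?V n}\<rparr>"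
  have inj: "inj_on (to_nat_on (verts H)) (verts H)"
    using assms by (simp add: countable_hypergraph_def inj_on_to_nat_on)
  have "finite (?V n)" for n
    by (rule finite_imageD[of "to_nat_on (verts H)"])
      (auto intro: finite_subset[of _ "{..<n}"] inj_on_subset[OF inj])
  then have "finite_hypergraph (?C n)" for n
    using assms by (auto simp: finite_hypergraph_def hypergraph_def countable_hypergraph_def)
  moreover have "induced_subhypergraph (?C n) (?C (Suc n))" for n
    unfolding induced_subhypergraph_def by auto
  moreover have "(\<Union>n. ?V n) = verts H" by auto
  moreover have "\<exists>n. E \<subseteq> ?V n" if "E \<in> edges H" for E
  proof -
    have E: "finite E" "E \<subseteq> verts H"
      using assms that by (auto simp: countable_hypergraph_def hypergraph_def)
    then obtain n where "\<forall>i\<in>to_nat_on (verts H) ` E. i < n"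
      using finite_nat_set_iff_bounded by blast
    with E(2) show ?thesis by blast
  qed
  then have "(\<Union>n. edges (?C n)) = edges H" by auto
  ultimately show "hchain ?C H" unfolding hchain_def by simp
qed

text \<open>Members of a chain inherit the rank bound because their edges are edges of
  \<open>H\<close>; their limit is approximated by finite densities and hence is one itself.\<close>

lemma indep_density_in_fin_densities:
  fixes H :: "'a hypergraph"
  assumes p: "0 < p" "p \<le> 1" and H: "countable_hypergraph H" "rank H \<le> enat k"
  shows "indep_density p H \<in> fin_densities TYPE('a) k p"
proof -
  obtain C where C: "hchain C H" using hchain_exists[OF H(1)] by blast
  obtain L where L: "(\<lambda>n. fin_indep_density p (C n)) \<longlonglongrightarrow> L"
    using hchain_convergent[OF _ p(2) C] p(1) by auto
  have "finite_hypergraph (C n)" "rank (C n) \<le> enat k" for n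
    using C H(2) by (auto simp: hchain_def rank_le_iff)
  then have mem: "fin_indep_density p (C n) \<in> fin_densities TYPE('a) k p" for n
    unfolding fin_densities_def by blast
  have "L \<in> fin_densities TYPE('a) k p"
  proof (rule fin_densities_approachable[OF p])
    fix \<epsilon> :: real assume "\<epsilon> > 0"
    then obtain n where "\<bar>fin_indep_density p (C n) - L\<bar> < \<epsilon>"
      using LIMSEQ_D[OF L] by (metis order_refl real_norm_def)
    with mem show "\<exists>y\<in>fin_densities TYPE('a) k p. \<bar>y - L\<bar> < \<epsilon>" by blast
  qed
  then show ?thesis using indep_density_eq_limit[OF _ p(2) C L] p(1) by simp
qed

text \<open>The empty edge lies in every vertex set, so with it no set is independent; its size 0
  respects every rank bound.\<close>

lemma zero_in_fin_densities: "0 \<in> fin_densities TYPE('a) k p"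
proof -
  let ?H = "\<lparr>verts = {}, edges = {{}}\<rparr> :: 'a hypergraph"
  have "fin_indep_density p ?H = 0" by (simp add: fin_indep_density_def independent_def)
  moreover have "finite_hypergraph ?H" "rank ?H \<le> enat k"
    by (auto simp: finite_hypergraph_def hypergraph_def rank_le_iff)
  ultimately show ?thesis
    unfolding fin_densities_def by (intro CollectI exI[of _ ?H]) simp
qed

theorem mainTheorem1:
  fixes k :: nat and p :: real
  assumes "k \<ge> 1" and "0 < p" and "p < 1"
  shows "closed (indep_densities k p) \<and>
    indep_densities k p =
      {0} \<union> {fin_indep_density p H | H :: nat hypergraph.
               finite_hypergraph H \<and> rank H \<le> enat k}"
proof -
  have p: "0 < p" "0 \<le> p" "p \<le> 1" using assms by simp_all
  have "indep_densities k p = fin_densities TYPE(nat) k p"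
  proof (intro equalityI subsetI)
    fix y assume "y \<in> indep_densities k p"
    then show "y \<in> fin_densities TYPE(nat) k p"
      unfolding indep_densities_def using indep_density_in_fin_densities[OF p(1,3)] by blast
  next
    fix y assume "y \<in> fin_densities TYPE(nat) k p"
    then obtain H :: "nat hypergraph" where H: "finite_hypergraph H" "rank H \<le> enat k"
      "y = fin_indep_density p H" unfolding fin_densities_def by blast
    then have "countable_hypergraph H" "y = indep_density p H"
      by (simp_all add: indep_density_finite[OF p(2,3)])
        (simp add: finite_hypergraph_def countable_hypergraph_def countable_finite)
    with H(2) show "y \<in> indep_densities k p" unfolding indep_densities_def by blast
  qed
  then show ?thesis
    using closed_fin_densities[OF p(1,3), where 'a = nat and k = k]
      zero_in_fin_densities[where 'a = nat and k = k and p = p]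
    unfolding fin_densities_def by (simp add: insert_absorb del: mem_Collect_eq)
qed

end
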